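(* Let $f:\Omega\subseteq\mathbb{E}_3\to\mathbb{R}$, let $\mathbf{a}_1,\mathbf{a}_2,\mathbf{a}_3,\mathbf{a}_4\in\Omega$ be not coplanar, and suppose that the mirrored points $\overline{\mathbf{a}_1}$ (of $\mathbf{a}_1$ through the plane passing through $\mathbf{a}_2,\mathbf{a}_3,\mathbf{a}_4$) and $\overline{\mathbf{a}_2}$ (of $\mathbf{a}_2$ through the line passing through $\mathbf{a}_3,\mathbf{a}_4$) lie in $\Omega$. Let $\overline{\mathbf{r}}_{f_{(\mathbf{a}_1,\mathbf{a}_2,\mathbf{a}_3,\mathbf{a}_4)}}=\big(\overline{\Delta}f_{(\mathbf{a}_1,\mathbf{a}_2,\mathbf{a}_3,\mathbf{a}_4)}\big)\big(\Delta_{(\mathbf{a}_1,\mathbf{a}_2,\mathbf{a}_3,\mathbf{a}_4)}\big)^{-1}$, computed in the Clifford algebra $\mathbb{G}_3$. Then $$\overline{\mathbf{r}}_{f_{(\mathbf{a}_1,\mathbf{a}_2,\mathbf{a}_3,\mathbf{a}_4)}}=\frac{f(\overline{\mathbf{a}_1})-f(\mathbf{a}_1)}{\overline{\mathbf{a}_1}-\mathbf{a}_1}+\frac{f(\overline{\mathbf{a}_2})-f(\mathbf{a}_2)}{\overline{\mathbf{a}_2}-\mathbf{a}_2}+\frac{f(\mathbf{a}_4)-f(\mathbf{a}_3)}{\mathbf{a}_4-\mathbf{a}_3}.$$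
   Context: $\mathbb{E}_3$ is the three-dimensional real Euclidean vector space with scalar product $\mathbf{u}\cdot\mathbf{v}$; its vectors are also called points. $\mathbb{G}_3=\mathcal{C}\ell(\mathbb{E}_3)$ is the Clifford (geometric) algebra generated by $\mathbb{E}_3$, an associative algebra of dimension $8$ with product denoted by juxtaposition and $\mathbf{v}\mathbf{v}=\mathbf{v}\cdot\mathbf{v}$ for every vector $\mathbf{v}$. For vectors, $\mathbf{u}_1\wedge\cdots\wedge\mathbf{u}_k=\frac1{k!}\sum_{\sigma\in\mathcal{S}_k}\epsilon_\sigma\,\mathbf{u}_{\sigma_1}\cdots\mathbf{u}_{\sigma_k}$, where $\epsilon_\sigma$ is the sign of $\sigma$. For $\alpha\in\mathbb{R}$ and a non-zero vector $\mathbf{v}$, $\frac{\alpha}{\mathbf{v}}=\alpha\mathbf{v}^{-1}=\frac{\alpha}{|\mathbf{v}|^2}\mathbf{v}$. Not coplanar means that the four points are the vertices of a non degenerate tetrahedron. Define $\Delta_{(\mathbf{a}_1,\mathbf{a}_2,\mathbf{a}_3,\mathbf{a}_4)}=(\mathbf{a}_2-\mathbf{a}_1)\wedge(\mathbf{a}_3-\mathbf{a}_1)\wedge(\mathbf{a}_4-\mathbf{a}_1)$, which is then invertible in $\mathbb{G}_3$. The mirrored point of $\mathbf{p}$ through an affine subspace is its orthogonal reflection $2P(\mathbf{p})-\mathbf{p}$, with $P$ the orthogonal projection onto that affine subspace. The mean multi-difference pseudo-vector is $$\overline{\Delta}f_{(\mathbf{a}_1,\mathbf{a}_2,\mathbf{a}_3,\mathbf{a}_4)}=\tfrac14\Big\{[f(\overline{\mathbf{a}_1})-f(\mathbf{a}_1)](\overline{\mathbf{a}_2}-\mathbf{a}_2)\wedge(\mathbf{a}_4-\mathbf{a}_3)-[f(\overline{\mathbf{a}_2})-f(\mathbf{a}_2)](\overline{\mathbf{a}_1}-\mathbf{a}_1)\wedge(\mathbf{a}_4-\mathbf{a}_3)+[f(\mathbf{a}_4)-f(\mathbf{a}_3)](\overline{\mathbf{a}_1}-\mathbf{a}_1)\wedge(\overline{\mathbf{a}_2}-\mathbf{a}_2)\Big\}.$$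 *)

theory Defs
  imports "HOL-Analysis.Analysis" "HOL-Combinatorics.Permutations"
begin

section \<open>Clifford algebras of Euclidean spaces\<close>

text \<open>
  A Clifford algebra of the Euclidean space \<open>'e\<close> is given, up to isomorphism, as an associative
  unital real algebra \<open>'g\<close> with a linear map \<open>\<iota>\<close> from \<open>'e\<close> whose image generates \<open>'g\<close>, such that
  \<open>\<iota> v * \<iota> v\<close> is the scalar \<open>v \<bullet> v\<close> and \<open>'g\<close> has the full dimension \<open>2 ^ DIM('e)\<close>.
  The map \<open>\<iota>\<close> is the inclusion of the vectors in the algebra.  Since \<open>dim\<close> of an
  infinite-dimensional space is \<open>0\<close>, the last condition also says that \<open>'g\<close> is finite-dimensional.
\<close>

definition generates_algebra :: "'g::real_algebra_1 set \<Rightarrow> bool" where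
  "generates_algebra X \<longleftrightarrow>
     (\<forall>S. subspace S \<and> 1 \<in> S \<and> (\<forall>x\<in>S. \<forall>y\<in>S. x * y \<in> S) \<and> X \<subseteq> S \<longrightarrow> S = UNIV)"

definition clifford_algebra :: "('e::euclidean_space \<Rightarrow> 'g::real_algebra_1) \<Rightarrow> bool" where
  "clifford_algebra \<iota> \<longleftrightarrow>
     linear \<iota> \<and> (\<forall>v. \<iota> v * \<iota> v = of_real (v \<bullet> v)) \<and>
     generates_algebra (range \<iota>) \<and> dim (UNIV :: 'g set) = 2 ^ DIM('e)"

text \<open>\<open>wedge \<iota> [u\<^sub>1, \<dots>, u\<^sub>k]\<close> is the antisymmetrised product of the vectors; indices start at 0.\<close>

definition wedge :: "('e::euclidean_space \<Rightarrow> 'g::real_algebra_1) \<Rightarrow> 'e list \<Rightarrow> 'g" where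
  "wedge \<iota> us =
     (1 / fact (length us)) *\<^sub>R
       (\<Sum>\<sigma> | \<sigma> permutes {..<length us}.
          of_int (sign \<sigma>) *\<^sub>R prod_list (map (\<lambda>i. \<iota> (us ! \<sigma> i)) [0..<length us]))"

text \<open>The two-sided inverse, meaningful only for invertible elements.\<close>

definition alg_inverse :: "'g::real_algebra_1 \<Rightarrow> 'g" where
  "alg_inverse x = (THE y. x * y = 1 \<and> y * x = 1)"

definition vec_divide :: "('e::euclidean_space \<Rightarrow> 'g::real_algebra_1) \<Rightarrow> real \<Rightarrow> 'e \<Rightarrow> 'g" where
  "vec_divide \<iota> \<alpha> v = \<alpha> *\<^sub>R alg_inverse (\<iota> v)"

lemma alg_inverse_eq:
  assumes "x * y = 1" "y * x = 1"
  shows "alg_inverse x = y"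
  unfolding alg_inverse_def
proof (rule the_equality)
  fix z assume z: "x * z = 1 \<and> z * x = 1"
  have "z = z * (x * y)" using assms by simp
  also have "\<dots> = y" using z by (simp flip: mult.assoc)
  finally show "z = y" .
qed (use assms in simp)

lemma vec_divide_eq:
  assumes "clifford_algebra \<iota>" "v \<noteq> 0"
  shows "vec_divide \<iota> \<alpha> v = (\<alpha> / (norm v)\<^sup>2) *\<^sub>R \<iota> v"
proof -
  have sq: "\<iota> v * \<iota> v = of_real ((norm v)\<^sup>2)"
    using assms(1) by (simp add: clifford_algebra_def power2_norm_eq_inner)
  have "alg_inverse (\<iota> v) = (1 / (norm v)\<^sup>2) *\<^sub>R \<iota> v"
    by (rule alg_inverse_eq) (use assms(2) sq in \<open>simp_all add: of_real_def\<close>)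
  then show ?thesis by (simp add: vec_divide_def)
qed


section \<open>Mirrored points\<close>

definition orth_proj :: "'e::euclidean_space set \<Rightarrow> 'e \<Rightarrow> 'e" where
  "orth_proj S p = (THE q. q \<in> S \<and> (\<forall>x\<in>S. \<forall>y\<in>S. (p - q) \<bullet> (x - y) = 0))"

definition mirror :: "'e::euclidean_space set \<Rightarrow> 'e \<Rightarrow> 'e" where
  "mirror S p = 2 *\<^sub>R orth_proj S p - p"

lemma orth_proj_unique_exists:
  fixes S :: "'e::euclidean_space set"
  assumes "affine S" "S \<noteq> {}"
  shows "\<exists>!q. q \<in> S \<and> (\<forall>x\<in>S. \<forall>y\<in>S. (p - q) \<bullet> (x - y) = 0)"
proof -
  obtain z where z: "z \<in> S" using assms(2) by blast
  define V where "V = (\<lambda>x. x - z) ` S"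
  have V: "subspace V"
    using affine_diffs_subspace_subtract[OF assms(1) z] by (simp add: V_def)
  obtain v w where v: "v \<in> span V" and w: "\<And>u. u \<in> span V \<Longrightarrow> orthogonal w u" and e: "p - z = v + w"
    using orthogonal_subspace_decomp_exists[of V "p - z"] by metis
  have sp: "span V = V" using V by (simp add: span_eq_iff)
  show ?thesis
  proof (rule ex1I[of _ "z + v"])
    show "z + v \<in> S \<and> (\<forall>x\<in>S. \<forall>y\<in>S. (p - (z + v)) \<bullet> (x - y) = 0)"
    proof (intro conjI ballI)
      have "v \<in> V" using v sp by simp
      then show "z + v \<in> S" by (auto simp: V_def)
      fix x y assume "x \<in> S" "y \<in> S"
      then have "x - z \<in> V" "y - z \<in> V" by (simp_all add: V_def)
      then have "(x - z) - (y - z) \<in> V" by (rule subspace_diff[OF V])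
      then have "orthogonal w (x - y)" by (intro w) (simp add: sp)
      moreover have "p - (z + v) = w" using e by (simp add: algebra_simps)
      ultimately show "(p - (z + v)) \<bullet> (x - y) = 0" by (simp add: orthogonal_def)
    qed
    then have *: "z + v \<in> S" "\<And>x y. x \<in> S \<Longrightarrow> y \<in> S \<Longrightarrow> (p - (z + v)) \<bullet> (x - y) = 0" by auto
    fix q assume q: "q \<in> S \<and> (\<forall>x\<in>S. \<forall>y\<in>S. (p - q) \<bullet> (x - y) = 0)"
    have "(p - q) \<bullet> ((z + v) - q) = 0" "(p - (z + v)) \<bullet> ((z + v) - q) = 0"
      using q * by blast+
    then have "((z + v) - q) \<bullet> ((z + v) - q) = 0" by (simp add: inner_diff_left)
    then show "q = z + v" by simp
  qed
qed


section \<open>Multi-differences\<close>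

definition multi_delta ::
    "('e::euclidean_space \<Rightarrow> 'g::real_algebra_1) \<Rightarrow> 'e \<Rightarrow> 'e \<Rightarrow> 'e \<Rightarrow> 'e \<Rightarrow> 'g" where
  "multi_delta \<iota> a1 a2 a3 a4 = wedge \<iota> [a2 - a1, a3 - a1, a4 - a1]"

definition mean_multi_diff ::
    "('e::euclidean_space \<Rightarrow> 'g::real_algebra_1) \<Rightarrow> ('e \<Rightarrow> real) \<Rightarrow> 'e \<Rightarrow> 'e \<Rightarrow> 'e \<Rightarrow> 'e \<Rightarrow> 'g" where
  "mean_multi_diff \<iota> f a1 a2 a3 a4 =
     (let b1 = mirror (affine hull {a2, a3, a4}) a1;
          b2 = mirror (affine hull {a3, a4}) a2
      in (1 / 4) *\<^sub>R
         ((f b1 - f a1) *\<^sub>R wedge \<iota> [b2 - a2, a4 - a3]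
          - (f b2 - f a2) *\<^sub>R wedge \<iota> [b1 - a1, a4 - a3]
          + (f a4 - f a3) *\<^sub>R wedge \<iota> [b1 - a1, b2 - a2]))"

definition mean_ratio ::
    "('e::euclidean_space \<Rightarrow> 'g::real_algebra_1) \<Rightarrow> ('e \<Rightarrow> real) \<Rightarrow> 'e \<Rightarrow> 'e \<Rightarrow> 'e \<Rightarrow> 'e \<Rightarrow> 'g" where
  "mean_ratio \<iota> f a1 a2 a3 a4 =
     mean_multi_diff \<iota> f a1 a2 a3 a4 * alg_inverse (multi_delta \<iota> a1 a2 a3 a4)"


section \<open>Existence of the Clifford algebra of three-dimensional space\<close>

text \<open>
  The complex 2 by 2 matrices, with rows \<open>(a, b)\<close> and \<open>(c, d)\<close>, form a Clifford algebra of
  \<open>real ^ 3\<close> through the Pauli matrices, so \<open>clifford_algebra\<close> is satisfiable for \<open>DIM('e) = 3\<close>.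
\<close>

typedef cmat2 = "UNIV :: (complex \<times> complex \<times> complex \<times> complex) set"
  morphisms entries Cmat by simp

setup_lifting type_definition_cmat2

instantiation cmat2 :: real_algebra_1
begin

lift_definition zero_cmat2 :: cmat2 is "(0, 0, 0, 0)" .
lift_definition one_cmat2 :: cmat2 is "(1, 0, 0, 1)" .
lift_definition plus_cmat2 :: "cmat2 \<Rightarrow> cmat2 \<Rightarrow> cmat2" is "(+)" .
lift_definition minus_cmat2 :: "cmat2 \<Rightarrow> cmat2 \<Rightarrow> cmat2" is "(-)" .
lift_definition uminus_cmat2 :: "cmat2 \<Rightarrow> cmat2" is uminus .
lift_definition scaleR_cmat2 :: "real \<Rightarrow> cmat2 \<Rightarrow> cmat2" is scaleR .
lift_definition times_cmat2 :: "cmat2 \<Rightarrow> cmat2 \<Rightarrow> cmat2" is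
  "\<lambda>(a, b, c, d) (a', b', c', d').
     (a * a' + b * c', a * b' + b * d', c * a' + d * c', c * b' + d * d')" .

instance
proof
  fix x y z :: cmat2 and r s :: real
  show "x + y + z = x + (y + z)" by transfer (simp add: add.assoc)
  show "x + y = y + x" by transfer (simp add: add.commute)
  show "0 + x = x" by transfer (auto simp flip: zero_prod_def)
  show "- x + x = 0" by transfer (auto simp: zero_prod_def)
  show "x - y = x + - y" by transfer simp
  show "r *\<^sub>R (x + y) = r *\<^sub>R x + r *\<^sub>R y" by transfer (simp add: scaleR_add_right)
  show "(r + s) *\<^sub>R x = r *\<^sub>R x + s *\<^sub>R x" by transfer (simp add: scaleR_add_left)
  show "r *\<^sub>R s *\<^sub>R x = (r * s) *\<^sub>R x" by transfer simp
  show "1 *\<^sub>R x = x" by transfer simp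
  show "x * y * z = x * (y * z)" by transfer (auto simp: algebra_simps)
  show "(x + y) * z = x * z + y * z" by transfer (auto simp: algebra_simps)
  show "x * (y + z) = x * y + x * z" by transfer (auto simp: algebra_simps)
  show "r *\<^sub>R x * y = r *\<^sub>R (x * y)" by transfer (auto simp: algebra_simps)
  show "x * r *\<^sub>R y = r *\<^sub>R (x * y)" by transfer (auto simp: algebra_simps)
  show "1 * x = x" by transfer auto
  show "x * 1 = x" by transfer auto
  show "(0::cmat2) \<noteq> 1" by transfer simp
qed

end

lift_definition pauli :: "real ^ 3 \<Rightarrow> cmat2" is
  "\<lambda>v. (of_real (v $ 3), Complex (v $ 1) (- v $ 2), Complex (v $ 1) (v $ 2), - of_real (v $ 3))" .

lemma dim_cmat2: "dim (UNIV :: cmat2 set) = 8"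
proof -
  have lin: "linear Cmat"
    by (rule linearI) (simp_all add: plus_cmat2.abs_eq scaleR_cmat2.abs_eq)
  have inj: "inj Cmat" by (simp add: inj_def Cmat_inject)
  have surj: "surj Cmat" by (metis entries_inverse surj_def)
  let ?B = "Basis :: (complex \<times> complex \<times> complex \<times> complex) set"
  have "independent (Cmat ` ?B)"
    using linear_independent_injective_image[OF lin independent_Basis] inj
    by (simp add: inj_on_subset)
  moreover have "span (Cmat ` ?B) = UNIV"
    using linear_span_image[OF lin, of ?B] surj by simp
  ultimately have "dim (UNIV :: cmat2 set) = card (Cmat ` ?B)"
    by (metis dim_eq_card span_UNIV)
  also have "\<dots> = card ?B" using inj by (simp add: card_image inj_on_subset)
  also have "\<dots> = 8" using DIM_complex by simp
  finally show ?thesis .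
qed

lemma pauli_generates: "generates_algebra (range pauli)"
  unfolding generates_algebra_def
proof (intro allI impI, elim conjE)
  fix S :: "cmat2 set"
  assume S: "subspace S" and one: "1 \<in> S" and mul: "\<forall>x\<in>S. \<forall>y\<in>S. x * y \<in> S" and X: "range pauli \<subseteq> S"
  define e where "e i = pauli (axis i 1)" for i
  have e: "e i \<in> S" for i using X by (auto simp: e_def)
  have "x \<in> S" for x
  proof -
    obtain a b c d where x: "x = Cmat (a, b, c, d)" by (metis entries_inverse prod_cases4)
    have "x = ((Re a + Re d) / 2) *\<^sub>R 1 + ((Re a - Re d) / 2) *\<^sub>R e 3
          + ((Im a + Im d) / 2) *\<^sub>R (e 1 * (e 2 * e 3)) + ((Im a - Im d) / 2) *\<^sub>R (e 1 * e 2)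
          + ((Re b + Re c) / 2) *\<^sub>R e 1 + ((Im c - Im b) / 2) *\<^sub>R e 2
          + ((Im b + Im c) / 2) *\<^sub>R (e 2 * e 3) + ((Re b - Re c) / 2) *\<^sub>R (e 3 * e 1)"
      unfolding x e_def pauli_def one_cmat2_def
      by (simp add: plus_cmat2.abs_eq scaleR_cmat2.abs_eq times_cmat2.abs_eq Cmat_inject
          complex_eq_iff axis_def field_simps)
    also have "\<dots> \<in> S"
      using one e mul S by (intro subspace_add subspace_scale) auto
    finally show ?thesis .
  qed
  then show "S = UNIV" by blast
qed

lemma clifford_algebra_pauli: "clifford_algebra pauli"
  unfolding clifford_algebra_def
proof (intro conjI allI)
  show "linear pauli"
    by (rule linearI) (transfer, simp add: complex_eq_iff)+
  fix v :: "real ^ 3"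
  show "pauli v * pauli v = of_real (v \<bullet> v)"
    unfolding of_real_def
    by transfer (simp add: complex_eq_iff inner_vec_def sum_3 power2_eq_square)
  show "generates_algebra (range pauli)" by (rule pauli_generates)
  show "dim (UNIV :: cmat2 set) = 2 ^ DIM(real ^ 3)" by (simp add: dim_cmat2)
qed

end

theory Submission
  imports Defs
begin

text \<open>
  Put \<open>w\<^sub>1 = b1 - a1\<close>, \<open>w\<^sub>2 = b2 - a2\<close> and \<open>d = a4 - a3\<close>.  The mirrored points are built so that these
  three vectors are the steps of a Gram--Schmidt process on the edges of the tetrahedron: \<open>w\<^sub>2\<close> is
  normal to the line through \<open>a3\<close>, \<open>a4\<close>, and \<open>w\<^sub>1\<close> is normal to the plane through \<open>a2\<close>, \<open>a3\<close>, \<open>a4\<close>.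
  Orthogonal vectors anticommute in a Clifford algebra, and their wedge product is their product.
  So the mean multi-difference is \<open>1/4 (F\<^sub>1 w\<^sub>2 d - F\<^sub>2 w\<^sub>1 d + F\<^sub>3 w\<^sub>1 w\<^sub>2)\<close>, where the \<open>F\<^sub>i\<close> are
  the differences of \<open>f\<close>.

  A wedge product does not change when a multiple of one factor is added to another, and
  Gram--Schmidt uses only such changes up to the factors \<open>2\<close> that come from reflecting instead
  of projecting; hence \<open>\<Delta> = 1/4 w\<^sub>1 w\<^sub>2 d\<close> (\<open>multi_delta_eq_mult_mirror_diffs\<close>).
  Non-coplanarity makes the three vectors non-zero, so \<open>\<Delta>\<close> has the inverse \<open>4 d\<^sup>-\<^sup>1 w\<^sub>2\<^sup>-\<^sup>1 w\<^sub>1\<^sup>-\<^sup>1\<close>.  In the quotient each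
  product of two vectors cancels against two of the three inverses; bringing the middle factor into
  place costs one transposition, which absorbs the minus sign of the second term
  (\<open>anticommuting_quotient\<close>).
\<close>

lemma clifford_algebra_linear: "clifford_algebra \<iota> \<Longrightarrow> linear \<iota>"
  by (simp add: clifford_algebra_def)

text \<open>Polarising \<open>v v = v \<bullet> v\<close> at \<open>u + v\<close> leaves \<open>u v + v u = 2 u \<bullet> v\<close>.\<close>

lemma clifford_anticommute:
  assumes "clifford_algebra \<iota>" "u \<bullet> v = 0"
  shows "\<iota> u * \<iota> v = - (\<iota> v * \<iota> u)"
proof -
  note lin = clifford_algebra_linear[OF assms(1)]
  have sq: "\<iota> x * \<iota> x = of_real (x \<bullet> x)" for x
    using assms(1) by (simp add: clifford_algebra_def)
  have "\<iota> (u + v) * \<iota> (u + v) = of_real (u \<bullet> u) + of_real (v \<bullet> v)"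
    unfolding sq using assms(2) by (simp add: inner_add inner_commute)
  then have "\<iota> u * \<iota> v + \<iota> v * \<iota> u = 0"
    by (simp add: linear_add[OF lin] sq algebra_simps)
  then show ?thesis by (simp add: eq_neg_iff_add_eq_0)
qed

section \<open>Wedge products of two and three vectors\<close>

lemma wedge_2:
  fixes \<iota> :: "'e::euclidean_space \<Rightarrow> 'g::real_algebra_1"
  shows "wedge \<iota> [u, v] = (1/2) *\<^sub>R (\<iota> u * \<iota> v - \<iota> v * \<iota> u)"
proof -
  have "{..<2::nat} = insert 0 {1}" by auto
  then show ?thesis
    unfolding wedge_def
    by (simp add: sum_over_permutations_insert upt_rec fact_numeral numeral_2_eq_2
        sign_swap_id sign_compose permutation_swap_id Transposition.transpose_def)
qed

lemma wedge_3:
  fixes \<iota> :: "'e::euclidean_space \<Rightarrow> 'g::real_algebra_1"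
  shows "wedge \<iota> [u, v, w] = (1/6) *\<^sub>R
    (\<iota> u * \<iota> v * \<iota> w - \<iota> u * \<iota> w * \<iota> v - \<iota> v * \<iota> u * \<iota> w
      + \<iota> v * \<iota> w * \<iota> u + \<iota> w * \<iota> u * \<iota> v - \<iota> w * \<iota> v * \<iota> u)"
proof -
  have I: "{..<Suc (Suc (Suc 0))} = insert 0 (insert 1 {2})" by auto
  show ?thesis
    unfolding wedge_def
    by (simp add: I sum_over_permutations_insert upt_rec fact_numeral
        sign_swap_id sign_compose permutation_swap_id permutation_compose
        Transposition.transpose_def algebra_simps numeral_2_eq_2)
qed

lemma wedge_2_orthogonal:
  assumes "clifford_algebra \<iota>" "u \<bullet> v = 0"
  shows "wedge \<iota> [u, v] = \<iota> u * \<iota> v"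
proof -
  have "\<iota> v * \<iota> u = - (\<iota> u * \<iota> v)"
    using assms by (simp add: clifford_anticommute[of \<iota> v u] inner_commute)
  then show ?thesis by (simp add: wedge_2)
qed

lemma wedge_3_orthogonal:
  fixes \<iota> :: "'e::euclidean_space \<Rightarrow> 'g::real_algebra_1"
  assumes "clifford_algebra \<iota>" "u \<bullet> v = 0" "u \<bullet> w = 0" "v \<bullet> w = 0"
  shows "wedge \<iota> [u, v, w] = \<iota> u * \<iota> v * \<iota> w"
proof -
  have vu: "\<iota> v * \<iota> u = - (\<iota> u * \<iota> v)" and wu: "\<iota> w * \<iota> u = - (\<iota> u * \<iota> w)"
    and wv: "\<iota> w * \<iota> v = - (\<iota> v * \<iota> w)"
    using assms by (simp_all add: clifford_anticommute[of \<iota> v u]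
        clifford_anticommute[of \<iota> w u] clifford_anticommute[of \<iota> w v] inner_commute)
  have "\<iota> u * \<iota> w * \<iota> v = - (\<iota> u * \<iota> v * \<iota> w)" "\<iota> v * \<iota> u * \<iota> w = - (\<iota> u * \<iota> v * \<iota> w)"
    by (simp_all add: vu wv mult.assoc)
  moreover have "\<iota> v * \<iota> w * \<iota> u = \<iota> u * \<iota> v * \<iota> w"
    by (metis mult.assoc wu vu minus_mult_left minus_mult_right minus_minus)
  moreover have "\<iota> w * \<iota> u * \<iota> v = \<iota> u * \<iota> v * \<iota> w"
    by (metis mult.assoc wu wv minus_mult_left minus_mult_right minus_minus)
  moreover have "\<iota> w * \<iota> v * \<iota> u = - (\<iota> u * \<iota> v * \<iota> w)"
    using calculation(3) by (simp add: wv)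
  moreover have "x + x + x + x + x + x = 6 *\<^sub>R x" for x :: 'g
  proof -
    have "x + x + x + x + x + x = (1 + 1 + 1 + 1 + 1 + 1 :: real) *\<^sub>R x"
      by (simp only: scaleR_left_distrib scaleR_one)
    then show ?thesis by simp
  qed
  ultimately show ?thesis by (simp add: wedge_3)
qed

lemma wedge_3_shear:
  fixes \<iota> :: "'e::euclidean_space \<Rightarrow> 'g::real_algebra_1"
  assumes "linear \<iota>"
  shows wedge_3_shear_1_by_2: "wedge \<iota> [u + c *\<^sub>R v, v, w] = wedge \<iota> [u, v, w]"
    and wedge_3_shear_1_by_3: "wedge \<iota> [u + c *\<^sub>R w, v, w] = wedge \<iota> [u, v, w]"
    and wedge_3_shear_2_by_1: "wedge \<iota> [u, v + c *\<^sub>R u, w] = wedge \<iota> [u, v, w]"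
    and wedge_3_shear_2_by_3: "wedge \<iota> [u, v + c *\<^sub>R w, w] = wedge \<iota> [u, v, w]"
    and wedge_3_shear_3_by_2: "wedge \<iota> [u, v, w + c *\<^sub>R v] = wedge \<iota> [u, v, w]"
  by (simp_all add: wedge_3 linear_add[OF assms] linear_scale[OF assms] algebra_simps)

lemma wedge_3_scale:
  fixes \<iota> :: "'e::euclidean_space \<Rightarrow> 'g::real_algebra_1"
  assumes "linear \<iota>"
  shows "wedge \<iota> [a *\<^sub>R u, b *\<^sub>R v, c *\<^sub>R w] = (a * b * c) *\<^sub>R wedge \<iota> [u, v, w]"
  by (simp add: wedge_3 linear_scale[OF assms] algebra_simps)

lemma wedge_3_swap_1_2:
  fixes \<iota> :: "'e::euclidean_space \<Rightarrow> 'g::real_algebra_1"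
  assumes "linear \<iota>"
  shows "wedge \<iota> [- v, u, w] = wedge \<iota> [u, v, w]"
  by (simp add: wedge_3 linear_neg[OF assms] algebra_simps)

section \<open>Quotients of products of anticommuting elements\<close>

text \<open>
  The shape of the identity to be proved: \<open>z' * y' * x'\<close> is the inverse of \<open>x * y * z\<close>, and moving
  an inverse past one element changes the sign, past two it does not.
\<close>

lemma anticommuting_quotient:
  fixes x y z x' y' z' :: "'g::real_algebra_1"
  assumes inv: "x * x' = 1" "y * y' = 1" "z * z' = 1"
    and anti: "x * y' = - (y' * x)" "x * z' = - (z' * x)" "y * z' = - (z' * y)"
  shows "(r *\<^sub>R (y * z) - s *\<^sub>R (x * z) + t *\<^sub>R (x * y)) * (z' * y' * x')
    = r *\<^sub>R x' + s *\<^sub>R y' + t *\<^sub>R z'"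
proof -
  have "y * z * (z' * y' * x') = y * (z * z') * y' * x'" by (simp only: mult.assoc)
  then have 1: "y * z * (z' * y' * x') = x'" using inv by simp
  have "x * z * (z' * y' * x') = x * (z * z') * y' * x'" by (simp only: mult.assoc)
  also have "\<dots> = - (y' * (x * x'))" using inv anti by (simp add: mult.assoc)
  finally have 2: "x * z * (z' * y' * x') = - y'" using inv by simp
  have "x * y * (z' * y' * x') = x * (y * z') * y' * x'" by (simp only: mult.assoc)
  also have "\<dots> = - (x * z') * (y * y') * x'" by (simp add: anti(3) mult.assoc)
  also have "\<dots> = z' * (x * x')" by (simp add: anti(2) inv(2) mult.assoc[of z'])
  finally have 3: "x * y * (z' * y' * x') = z'" using inv by simp
  show ?thesis
    by (simp only: distrib_right left_diff_distrib mult_scaleR_left 1 2 3) simp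
qed

section \<open>Orthogonal projections and the tetrahedron\<close>

lemma orth_proj_affine_hull:
  fixes S :: "'e::euclidean_space set"
  assumes "S \<noteq> {}"
  shows orth_proj_in_affine_hull: "orth_proj (affine hull S) p \<in> affine hull S"
    and orth_proj_orthogonal: "x \<in> affine hull S \<Longrightarrow> y \<in> affine hull S
      \<Longrightarrow> (p - orth_proj (affine hull S) p) \<bullet> (x - y) = 0"
  using theI'[OF orth_proj_unique_exists[of "affine hull S" p]] assms
  by (auto simp: orth_proj_def affine_affine_hull)

lemma mirror_diff: "mirror S p - p = 2 *\<^sub>R (orth_proj S p - p)"
  by (simp add: mirror_def scaleR_2)

lemma mirror_eq_self_in_affine_hull:
  assumes "S \<noteq> {}" "mirror (affine hull S) p = p"
  shows "p \<in> affine hull S"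
  using orth_proj_in_affine_hull[OF assms(1), of p] mirror_diff[of "affine hull S" p] assms(2)
  by simp

lemma mirror_diff_orthogonal:
  assumes "x \<in> affine hull S" "y \<in> affine hull S"
  shows "(mirror (affine hull S) p - p) \<bullet> (x - y) = 0"
proof -
  have "S \<noteq> {}" using assms(1) by auto
  then have "(p - orth_proj (affine hull S) p) \<bullet> (x - y) = 0"
    using assms by (intro orth_proj_orthogonal)
  then show ?thesis by (simp add: mirror_diff inner_diff_left)
qed

lemma mirror_diffs_orthogonal:
  fixes a1 a2 a3 a4 :: "'e::euclidean_space"
  defines "b1 \<equiv> mirror (affine hull {a2, a3, a4}) a1" and "b2 \<equiv> mirror (affine hull {a3, a4}) a2"
  shows "(b1 - a1) \<bullet> (b2 - a2) = 0" "(b1 - a1) \<bullet> (a4 - a3) = 0" "(b2 - a2) \<bullet> (a4 - a3) = 0"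
proof -
  have "orth_proj (affine hull {a3, a4}) a2 \<in> affine hull {a3, a4}"
    by (rule orth_proj_in_affine_hull) simp
  then have "orth_proj (affine hull {a3, a4}) a2 \<in> affine hull {a2, a3, a4}"
    using hull_mono[of "{a3, a4}" "{a2, a3, a4}" affine] by auto
  then show "(b1 - a1) \<bullet> (b2 - a2) = 0"
    unfolding b1_def b2_def mirror_diff[of _ a2] inner_scaleR_right
    by (simp add: mirror_diff_orthogonal hull_inc)
qed (simp_all add: b1_def b2_def mirror_diff_orthogonal hull_inc)

lemma not_coplanar_mirror_diffs_nonzero:
  fixes a1 a2 a3 a4 :: "'e::euclidean_space"
  assumes "\<not> coplanar {a1, a2, a3, a4}"
  shows "mirror (affine hull {a2, a3, a4}) a1 - a1 \<noteq> 0"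
    and "mirror (affine hull {a3, a4}) a2 - a2 \<noteq> 0"
    and "a4 - a3 \<noteq> 0"
proof -
  have *: "\<not> {a1, a2, a3, a4} \<subseteq> affine hull {u, v, w}" for u v w
    using assms by (auto simp: coplanar_def)
  have "a1 \<notin> affine hull {a2, a3, a4}"
    using *[of a2 a3 a4] by (auto simp: hull_inc)
  then show "mirror (affine hull {a2, a3, a4}) a1 - a1 \<noteq> 0"
    using mirror_eq_self_in_affine_hull[of "{a2, a3, a4}" a1] by auto
  have "a2 \<notin> affine hull {a1, a3, a4}"
    using *[of a1 a3 a4] by (auto simp: hull_inc)
  then have "a2 \<notin> affine hull {a3, a4}"
    using hull_mono[of "{a3, a4}" "{a1, a3, a4}" affine] by auto
  then show "mirror (affine hull {a3, a4}) a2 - a2 \<noteq> 0"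
    using mirror_eq_self_in_affine_hull[of "{a3, a4}" a2] by auto
  show "a4 - a3 \<noteq> 0"
    using *[of a1 a2 a3] by (auto simp: hull_inc)
qed

text \<open>
  Volume of a tetrahedron from its successive heights: the displacements \<open>n\<^sub>1\<close>, \<open>n\<^sub>2\<close> from \<open>a1\<close>, \<open>a2\<close> to
  their projections and the edge \<open>d\<close> arise from the edges at \<open>a1\<close> by shears, up to an order and
  a sign that compensate each other.
\<close>

lemma multi_delta_eq_mult_mirror_diffs:
  fixes \<iota> :: "'e::euclidean_space \<Rightarrow> 'g::real_algebra_1" and a1 a2 a3 a4 :: 'e
  assumes cl: "clifford_algebra \<iota>"
  defines "b1 \<equiv> mirror (affine hull {a2, a3, a4}) a1" and "b2 \<equiv> mirror (affine hull {a3, a4}) a2"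
  shows "multi_delta \<iota> a1 a2 a3 a4 = (1/4) *\<^sub>R (\<iota> (b1 - a1) * \<iota> (b2 - a2) * \<iota> (a4 - a3))"
proof -
  note lin = clifford_algebra_linear[OF cl]
  define q1 where "q1 = orth_proj (affine hull {a2, a3, a4}) a1"
  define q2 where "q2 = orth_proj (affine hull {a3, a4}) a2"
  define n1 n2 d where "n1 = q1 - a1" and "n2 = q2 - a2" and "d = a4 - a3"
  have "q1 \<in> affine hull {a2, a3, a4}"
    unfolding q1_def by (rule orth_proj_in_affine_hull) simp
  then obtain x \<alpha> \<beta> where q1: "q1 = x *\<^sub>R a2 + \<alpha> *\<^sub>R a3 + \<beta> *\<^sub>R a4" "x + \<alpha> + \<beta> = 1"
    unfolding affine_hull_3 by auto
  have "q2 \<in> affine hull {a3, a4}"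
    unfolding q2_def by (rule orth_proj_in_affine_hull) simp
  then obtain y \<gamma> where q2: "q2 = y *\<^sub>R a3 + \<gamma> *\<^sub>R a4" "y + \<gamma> = 1"
    unfolding affine_hull_2 by auto
  have \<alpha>: "\<alpha> = 1 - x - \<beta>" and y: "y = 1 - \<gamma>" using q1(2) q2(2) by auto
  \<comment> \<open>The edges at \<open>a1\<close> as shears of \<open>- n\<^sub>2\<close>, \<open>n\<^sub>1\<close>, \<open>d\<close>.  The coefficients come from the affine
    coordinates of the projections; their values cancel in the wedge product.\<close>
  have e2: "a2 - a1 = (- n2 + \<gamma> *\<^sub>R d) + 1 *\<^sub>R (a3 - a1)"
    unfolding n2_def d_def q2(1) y by (simp add: algebra_simps)
  have e3: "a3 - a1 = (n1 + (- \<beta> - x * \<gamma>) *\<^sub>R d) + (- x) *\<^sub>R (- n2)"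
    unfolding n1_def n2_def d_def q1(1) q2(1) y \<alpha> by (simp add: algebra_simps)
  have e4: "a4 - a1 = d + 1 *\<^sub>R (a3 - a1)"
    by (simp add: d_def)
  have "multi_delta \<iota> a1 a2 a3 a4 =
      wedge \<iota> [(- n2 + \<gamma> *\<^sub>R d) + 1 *\<^sub>R (a3 - a1), a3 - a1, d + 1 *\<^sub>R (a3 - a1)]"
    by (simp only: multi_delta_def e2[symmetric] e4[symmetric])
  also have "\<dots> = wedge \<iota> [- n2, a3 - a1, d]"
    by (simp only: wedge_3_shear_1_by_2[OF lin] wedge_3_shear_3_by_2[OF lin]
        wedge_3_shear_1_by_3[OF lin])
  also have "\<dots> = wedge \<iota> [- n2, n1, d]"
    by (simp only: e3 wedge_3_shear_2_by_1[OF lin] wedge_3_shear_2_by_3[OF lin])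
  also have "\<dots> = wedge \<iota> [n1, n2, d]"
    by (rule wedge_3_swap_1_2[OF lin])
  also have "\<dots> = (1/4) *\<^sub>R wedge \<iota> [b1 - a1, b2 - a2, a4 - a3]"
    using wedge_3_scale[OF lin, of 2 n1 2 n2 1 d]
    by (simp add: b1_def b2_def mirror_diff n1_def n2_def d_def q1_def q2_def)
  also have "wedge \<iota> [b1 - a1, b2 - a2, a4 - a3] = \<iota> (b1 - a1) * \<iota> (b2 - a2) * \<iota> (a4 - a3)"
    unfolding b1_def b2_def by (intro wedge_3_orthogonal cl mirror_diffs_orthogonal)
  finally show ?thesis .
qed

section \<open>The mean ratio\<close>

theorem proposition4p1:
  fixes \<iota> :: "'e::euclidean_space \<Rightarrow> 'g::real_algebra_1"
    and \<Omega> :: "'e set" and f :: "'e \<Rightarrow> real"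
    and a1 a2 a3 a4 b1 b2 :: 'e
  assumes dim3: "DIM('e) = 3"
    and clifford: "clifford_algebra \<iota>"
    and points: "a1 \<in> \<Omega>" "a2 \<in> \<Omega>" "a3 \<in> \<Omega>" "a4 \<in> \<Omega>"
    and not_coplanar: "\<not> coplanar {a1, a2, a3, a4}"
    and b1: "b1 = mirror (affine hull {a2, a3, a4}) a1" "b1 \<in> \<Omega>"
    and b2: "b2 = mirror (affine hull {a3, a4}) a2" "b2 \<in> \<Omega>"
  shows "mean_ratio \<iota> f a1 a2 a3 a4 =
    vec_divide \<iota> (f b1 - f a1) (b1 - a1)
    + vec_divide \<iota> (f b2 - f a2) (b2 - a2)
    + vec_divide \<iota> (f a4 - f a3) (a4 - a3)"
proof -
  define w1 w2 d where "w1 = b1 - a1" and "w2 = b2 - a2" and "d = a4 - a3"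
  define i1 i2 i3 where "i1 = vec_divide \<iota> 1 w1" and "i2 = vec_divide \<iota> 1 w2"
    and "i3 = vec_divide \<iota> 1 d"
  have nz: "w1 \<noteq> 0" "w2 \<noteq> 0" "d \<noteq> 0"
    unfolding w1_def w2_def d_def b1(1) b2(1)
    by (fact not_coplanar_mirror_diffs_nonzero[OF not_coplanar])+
  have orth: "w1 \<bullet> w2 = 0" "w1 \<bullet> d = 0" "w2 \<bullet> d = 0"
    unfolding w1_def w2_def d_def b1(1) b2(1) by (fact mirror_diffs_orthogonal)+
  have inv: "\<iota> v * vec_divide \<iota> 1 v = 1" "vec_divide \<iota> 1 v * \<iota> v = 1" if "v \<noteq> 0" for v
  proof -
    have "\<iota> v * \<iota> v = of_real ((norm v)\<^sup>2)"
      using clifford by (simp add: clifford_algebra_def power2_norm_eq_inner)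
    then show "\<iota> v * vec_divide \<iota> 1 v = 1" "vec_divide \<iota> 1 v * \<iota> v = 1"
      using that by (simp_all add: vec_divide_eq[OF clifford] of_real_def)
  qed
  have anti: "\<iota> u * vec_divide \<iota> 1 v = - (vec_divide \<iota> 1 v * \<iota> u)" if "v \<noteq> 0" "u \<bullet> v = 0" for u v
    using clifford_anticommute[OF clifford that(2)] that(1) by (simp add: vec_divide_eq[OF clifford])
  have delta: "multi_delta \<iota> a1 a2 a3 a4 = (1/4) *\<^sub>R (\<iota> w1 * \<iota> w2 * \<iota> d)"
    using multi_delta_eq_mult_mirror_diffs[OF clifford] by (simp add: w1_def w2_def d_def b1(1) b2(1))
  have "alg_inverse (multi_delta \<iota> a1 a2 a3 a4) = 4 *\<^sub>R (i3 * i2 * i1)"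
  proof (rule alg_inverse_eq)
    have "\<iota> w1 * \<iota> w2 * \<iota> d * (i3 * i2 * i1) = \<iota> w1 * (\<iota> w2 * (\<iota> d * i3) * i2) * i1"
      by (simp only: mult.assoc)
    then show "multi_delta \<iota> a1 a2 a3 a4 * (4 *\<^sub>R (i3 * i2 * i1)) = 1"
      using inv nz by (simp add: delta i1_def i2_def i3_def)
    have "i3 * i2 * i1 * (\<iota> w1 * \<iota> w2 * \<iota> d) = i3 * (i2 * (i1 * \<iota> w1) * \<iota> w2) * \<iota> d"
      by (simp only: mult.assoc)
    then show "4 *\<^sub>R (i3 * i2 * i1) * multi_delta \<iota> a1 a2 a3 a4 = 1"
      using inv nz by (simp add: delta i1_def i2_def i3_def)
  qed
  moreover have "mean_multi_diff \<iota> f a1 a2 a3 a4 = (1/4) *\<^sub>R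
      ((f b1 - f a1) *\<^sub>R (\<iota> w2 * \<iota> d) - (f b2 - f a2) *\<^sub>R (\<iota> w1 * \<iota> d)
        + (f a4 - f a3) *\<^sub>R (\<iota> w1 * \<iota> w2))"
    by (simp only: mean_multi_diff_def Let_def b1(1)[symmetric] b2(1)[symmetric]
        w1_def[symmetric] w2_def[symmetric] d_def[symmetric] orth wedge_2_orthogonal[OF clifford])
  ultimately have "mean_ratio \<iota> f a1 a2 a3 a4 =
      ((f b1 - f a1) *\<^sub>R (\<iota> w2 * \<iota> d) - (f b2 - f a2) *\<^sub>R (\<iota> w1 * \<iota> d)
        + (f a4 - f a3) *\<^sub>R (\<iota> w1 * \<iota> w2)) * (i3 * i2 * i1)"
    by (simp add: mean_ratio_def)
  also have "\<dots> = (f b1 - f a1) *\<^sub>R i1 + (f b2 - f a2) *\<^sub>R i2 + (f a4 - f a3) *\<^sub>R i3"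
    unfolding i1_def i2_def i3_def by (intro anticommuting_quotient inv anti nz orth)
  finally show ?thesis
    by (simp add: i1_def i2_def i3_def w1_def w2_def d_def vec_divide_def)
qed

end
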